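(* Consider the disturbed linear system $\bm{x}(k+1)=A\bm{x}(k)+B\bm{u}(k)+\bm{w}(k)$ with $\bm{w}(k)\in\mathcal{W}$ for all $k$, and the robust variable-horizon MPC problem $\mathbb{P}_k$ with search range $\Delta N\ge 0$, both as defined in the context. Suppose that at time $k$ (with measured state $\bm{x}(k)$ and previous optimal horizon $N_{k-1}^\ast$) problem $\mathbb{P}_k$ is feasible with optimal horizon $N_k^\ast\ge 1$, that $(\bm{z}_k^\ast(j))_{j=0}^{N_k^\ast}$, $(\bm{v}_k^\ast(j))_{j=0}^{N_k^\ast-1}$ is the corresponding optimal solution, and that the control $\bm{u}(k)=\bm{v}_k^\ast(0)+K(\bm{x}(k)-\bm{z}_k^\ast(0))$ is applied. Then, for every disturbance $\bm{w}(k)\in\mathcal{W}$, problem $\mathbb{P}_{k+1}$ (with state $\bm{x}(k+1)=A\bm{x}(k)+B\bm{u}(k)+\bm{w}(k)$ and previous optimal horizon $N_k^\ast$) is feasible for the horizon $N_{k+1}=N_k^\ast-1$.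
   Context: Set operations: for $\mathcal{A},\mathcal{B}\subseteq\mathbb{R}^d$, $\mathcal{A}\oplus\mathcal{B}=\{\bm{a}+\bm{b}:\bm{a}\in\mathcal{A},\bm{b}\in\mathcal{B}\}$ and $\mathcal{A}\ominus\mathcal{B}=\{\bm{a}:\{\bm{a}\}\oplus\mathcal{B}\subseteq\mathcal{A}\}$. System: $\bm{x}(k+1)=A\bm{x}(k)+B\bm{u}(k)+\bm{w}(k)$, with $\bm{x}(k),\bm{w}(k)\in\mathbb{R}^n$, $\bm{u}(k)\in\mathbb{R}^m$, real matrices $A,B$ of compatible size, and $(A,B)$ controllable. The state and input constraint sets $\mathcal{X}\subseteq\mathbb{R}^n$, $\mathcal{U}\subseteq\mathbb{R}^m$ are convex. The disturbance satisfies $\bm{w}(k)\in\mathcal{W}$, where $\mathcal{W}\subseteq\mathbb{R}^n$ is compact and convex with $0\in\mathcal{W}$. The gain $K\in\mathbb{R}^{m\times n}$ is fixed such that $A+BK$ is Schur (all eigenvalues have modulus less than $1$). $\mathcal{E}\subseteq\mathbb{R}^n$ is a fixed robust positively invariant set, i.e. $(A+BK)\mathcal{E}\oplus\mathcal{W}\subseteq\mathcal{E}$, such that $\mathcal{X}\ominus\mathcal{E}$ and $\mathcal{U}\ominus K\mathcal{E}$ are nonempty. Reference: $\bm{r}(k)\in\mathbb{R}^n$, $k=0,1,2,\dots$, is a given sequence of target states (the same sequence is used in the problems at all times). Cost: for a horizon $N$, nominal states $Z=(\bm{z}(0),\dots,\bm{z}(N))$ and nominal inputs $V=(\bm{v}(0),\dots,\bm{v}(N-1))$,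 at time $k$, $$J(Z,V,N)=\sum_{j=0}^{N}\|\bm{z}(j)-\bm{r}(k+j)\|_Q^2+\sum_{j=0}^{N-1}\|\bm{v}(j)\|_R^2+\gamma N,$$ where $Q,R$ are positive definite, $\gamma\ge 0$, and $\|\bm{y}\|_M^2=\bm{y}^\top M\bm{y}$. Problem $\mathbb{P}_k$: given $\bm{x}(k)$, the previous optimal horizon $N_{k-1}^\ast$, and a fixed integer $\Delta N\ge 0$, minimize $J(Z_k,V_k,N_k)$ over the horizon $N_k$, $Z_k=(\bm{z}_k(0),\dots,\bm{z}_k(N_k))$ and $V_k=(\bm{v}_k(0),\dots,\bm{v}_k(N_k-1))$ subject to: 1. $\bm{x}(k)\in\{\bm{z}_k(0)\}\oplus\mathcal{E}$ (the initial nominal state $\bm{z}_k(0)$ is a decision variable); 2. $\bm{z}_k(j+1)=A\bm{z}_k(j)+B\bm{v}_k(j)$ for $j\in\{0,\dots,N_k-1\}$; 3. $\bm{z}_k(j)\in\mathcal{X}\ominus\mathcal{E}$ for $j\in\{0,\dots,N_k-1\}$; 4. $\bm{v}_k(j)\in\mathcal{U}\ominus K\mathcal{E}$ for $j\in\{0,\dots,N_k-1\}$; 5. $\bm{z}_k(N_k)=\bm{r}(k+N_k)$; 6. $N_k$ is a nonnegative integer in the interval $[N_{k-1}^\ast-1-\Delta N,\;N_{k-1}^\ast-1+\Delta N]$. $N_k^\ast$ denotes the horizon of the optimal solution of $\mathbb{P}_k$. When $N_k=0$, $V_k$ is empty and constraints 2–4 are vacuous. "$\mathbb{P}_k$ is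 feasible for horizon $N$" means that there exist $Z_k,V_k$ which, together with $N_k=N$, satisfy all of constraints 1–6. *)

theory Defs
  imports "HOL-Analysis.Analysis"
begin

text \<open>The sum \<open>S + T\<close> of two sets is the Minkowski sum of \<^theory>\<open>HOL-Library.Set_Algebras\<close>.\<close>

definition pontryagin_diff :: "'a::plus set \<Rightarrow> 'a set \<Rightarrow> 'a set"  (infixl \<open>\<ominus>\<close> 65)
  where "S \<ominus> T = {a. {a} + T \<subseteq> S}"

text \<open>Kalman's condition that \<open>[B, A B, \<dots>, A ^ (n - 1) B]\<close> has rank \<open>n\<close>, the rank being
  the dimension of the column space. Here \<open>((**) A ^^ i) B\<close> is the matrix \<open>A ^ i B\<close>.\<close>

definition controllable :: "real^'n^'n \<Rightarrow> real^'m^'n \<Rightarrow> bool"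
  where "controllable A B \<longleftrightarrow>
    dim (\<Union>i<CARD('n). columns (((**) A ^^ i) B)) = CARD('n)"

definition complex_eigenvalue :: "real^'n^'n \<Rightarrow> complex \<Rightarrow> bool"
  where "complex_eigenvalue M l \<longleftrightarrow>
    (\<exists>v::complex^'n. v \<noteq> 0 \<and> map_matrix complex_of_real M *v v = l *s v)"

definition schur :: "real^'n^'n \<Rightarrow> bool"
  where "schur M \<longleftrightarrow> (\<forall>l. complex_eigenvalue M l \<longrightarrow> cmod l < 1)"

text \<open>\<open>\<parallel>y\<parallel>\<^sub>M\<^sup>2 = y\<^sup>T M y\<close>\<close>

definition wnorm_sq :: "real^'n^'n \<Rightarrow> real^'n \<Rightarrow> real"
  where "wnorm_sq M y = y \<bullet> (M *v y)"

definition positive_definite :: "real^'n^'n \<Rightarrow> bool"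
  where "positive_definite M \<longleftrightarrow> transpose M = M \<and> (\<forall>y. y \<noteq> 0 \<longrightarrow> y \<bullet> (M *v y) > 0)"

definition robust_pos_invariant :: "real^'n^'n \<Rightarrow> (real^'n) set \<Rightarrow> (real^'n) set \<Rightarrow> bool"
  where "robust_pos_invariant M W E \<longleftrightarrow> (*v) M ` E + W \<subseteq> E"

text \<open>For horizon \<open>N\<close>, the nominal states \<open>z 0, \<dots>, z N\<close> and nominal inputs
  \<open>v 0, \<dots>, v (N - 1)\<close> are given by functions on \<^typ>\<open>nat\<close>; the values of \<open>z\<close> beyond \<open>N\<close>
  and of \<open>v\<close> from \<open>N\<close> on are irrelevant to everything below.\<close>

definition mpc_cost ::
  "real^'n^'n \<Rightarrow> real^'m^'m \<Rightarrow> real \<Rightarrow> (nat \<Rightarrow> real^'n) \<Rightarrow>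
   nat \<Rightarrow> nat \<Rightarrow> (nat \<Rightarrow> real^'n) \<Rightarrow> (nat \<Rightarrow> real^'m) \<Rightarrow> real"
  where "mpc_cost Q R \<gamma> r k N z v =
    (\<Sum>j=0..N. wnorm_sq Q (z j - r (k + j))) + (\<Sum>j<N. wnorm_sq R (v j)) + \<gamma> * real N"

text \<open>The constraints of the problem at time \<open>k\<close> with measured state \<open>x\<close> and previous optimal
  horizon \<open>N_prev\<close>. The search interval for \<open>N\<close> is taken in \<^typ>\<open>int\<close>, as its lower end may be
  negative.\<close>

definition mpc_constraints ::
  "real^'n^'n \<Rightarrow> real^'m^'n \<Rightarrow> real^'n^'m \<Rightarrow> (real^'n) set \<Rightarrow> (real^'m) set \<Rightarrow> (real^'n) set \<Rightarrow>
   (nat \<Rightarrow> real^'n) \<Rightarrow> nat \<Rightarrow>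
   nat \<Rightarrow> real^'n \<Rightarrow> nat \<Rightarrow> nat \<Rightarrow> (nat \<Rightarrow> real^'n) \<Rightarrow> (nat \<Rightarrow> real^'m) \<Rightarrow> bool"
  where "mpc_constraints A B K X U E r \<Delta>N k x N_prev N z v \<longleftrightarrow>
    x \<in> {z 0} + E \<and>
    (\<forall>j<N. z (Suc j) = A *v z j + B *v v j) \<and>
    (\<forall>j<N. z j \<in> X \<ominus> E) \<and>
    (\<forall>j<N. v j \<in> U \<ominus> ((*v) K ` E)) \<and>
    z N = r (k + N) \<and>
    int N \<in> {int N_prev - 1 - int \<Delta>N .. int N_prev - 1 + int \<Delta>N}"

definition mpc_feasible ::
  "real^'n^'n \<Rightarrow> real^'m^'n \<Rightarrow> real^'n^'m \<Rightarrow> (real^'n) set \<Rightarrow> (real^'m) set \<Rightarrow> (real^'n) set \<Rightarrow>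
   (nat \<Rightarrow> real^'n) \<Rightarrow> nat \<Rightarrow> nat \<Rightarrow> real^'n \<Rightarrow> nat \<Rightarrow> nat \<Rightarrow> bool"
  where "mpc_feasible A B K X U E r \<Delta>N k x N_prev N \<longleftrightarrow>
    (\<exists>z v. mpc_constraints A B K X U E r \<Delta>N k x N_prev N z v)"

definition mpc_optimal ::
  "real^'n^'n \<Rightarrow> real^'m^'n \<Rightarrow> real^'n^'m \<Rightarrow> (real^'n) set \<Rightarrow> (real^'m) set \<Rightarrow> (real^'n) set \<Rightarrow>
   (nat \<Rightarrow> real^'n) \<Rightarrow> nat \<Rightarrow> real^'n^'n \<Rightarrow> real^'m^'m \<Rightarrow> real \<Rightarrow>
   nat \<Rightarrow> real^'n \<Rightarrow> nat \<Rightarrow> nat \<Rightarrow> (nat \<Rightarrow> real^'n) \<Rightarrow> (nat \<Rightarrow> real^'m) \<Rightarrow> bool"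
  where "mpc_optimal A B K X U E r \<Delta>N Q R \<gamma> k x N_prev N z v \<longleftrightarrow>
    mpc_constraints A B K X U E r \<Delta>N k x N_prev N z v \<and>
    (\<forall>N' z' v'. mpc_constraints A B K X U E r \<Delta>N k x N_prev N' z' v' \<longrightarrow>
      mpc_cost Q R \<gamma> r k N z v \<le> mpc_cost Q R \<gamma> r k N' z' v')"

end

theory Submission
  imports Defs
begin

text \<open>The candidate for time \<open>k + 1\<close> is the optimal plan with its first step
  dropped. Only the new initial condition needs work. The feedback term in \<open>u_k\<close> makes
  the error \<open>e = x - z 0\<close> evolve as \<open>(A + B ** K) *v e + w\<close>, independently
  of the nominal motion, so robust positive invariance keeps it in \<open>E\<close> for every
  \<open>w \<in> W\<close>. The other constraints are inherited by shifting the index;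
  \<open>tail_satisfies_constraints\<close> carries this out.\<close>

lemma tail_satisfies_constraints:
  fixes A :: "real^'n^'n" and B :: "real^'m^'n" and K :: "real^'n^'m"
  assumes inv: "robust_pos_invariant (A + B ** K) W E"
    and constr: "mpc_constraints A B K X U E r \<Delta>N k x N_prev (Suc N) z v"
    and w: "w \<in> W"
  shows "mpc_constraints A B K X U E r \<Delta>N (Suc k)
           (A *v x + B *v (v 0 + K *v (x - z 0)) + w) (Suc N) N (\<lambda>j. z (Suc j)) (\<lambda>j. v (Suc j))"
proof -
  obtain e where e: "e \<in> E" "x = z 0 + e"
    using constr unfolding mpc_constraints_def by (auto simp: set_plus_def)
  have "(A + B ** K) *v e + w \<in> E"
    using inv e(1) w unfolding robust_pos_invariant_def by (auto simp: set_plus_def)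
  \<comment> \<open>With \<open>x = z 0 + e\<close> the input is \<open>v 0 + K *v e\<close>; the
    nominal part \<open>A *v z 0 + B *v v 0\<close> is \<open>z (Suc 0)\<close> by the dynamics at
    \<open>j = 0\<close>, available since the horizon is \<open>Suc N\<close>.\<close>
  moreover have "A *v x + B *v (v 0 + K *v (x - z 0)) + w = z (Suc 0) + ((A + B ** K) *v e + w)"
    using constr unfolding mpc_constraints_def
    by (simp add: e(2) matrix_vector_right_distrib matrix_vector_mult_add_rdistrib
        matrix_vector_mul_assoc)
  ultimately have "A *v x + B *v (v 0 + K *v (x - z 0)) + w \<in> {z (Suc 0)} + E"
    by (auto simp: set_plus_def)
  \<comment> \<open>The terminal target is unchanged because \<open>k + Suc N = Suc k + N\<close>.
    With previous horizon \<open>Suc N\<close>, the search interval is centred at \<open>N\<close>,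
    so it contains \<open>N\<close> for every \<open>\<Delta>N\<close>.\<close>
  then show ?thesis
    using constr unfolding mpc_constraints_def by auto
qed

theorem proposition1:
  fixes A :: "real^'n^'n" and B :: "real^'m^'n" and K :: "real^'n^'m"
    and X W E :: "(real^'n) set" and U :: "(real^'m) set"
    and r :: "nat \<Rightarrow> real^'n"
    and Q :: "real^'n^'n" and R :: "real^'m^'m" and \<gamma> :: real
    and \<Delta>N k N_prev N_opt :: nat
    and x_k :: "real^'n" and u_k :: "real^'m"
    and z_opt :: "nat \<Rightarrow> real^'n" and v_opt :: "nat \<Rightarrow> real^'m"
  assumes "controllable A B"
    and "convex X" and "convex U"
    and "compact W" and "convex W" and "0 \<in> W"
    and "schur (A + B ** K)"
    and "robust_pos_invariant (A + B ** K) W E"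
    and "X \<ominus> E \<noteq> {}" and "U \<ominus> ((*v) K ` E) \<noteq> {}"
    and "positive_definite Q" and "positive_definite R" and "\<gamma> \<ge> 0"
    and "mpc_optimal A B K X U E r \<Delta>N Q R \<gamma> k x_k N_prev N_opt z_opt v_opt"
    and "N_opt \<ge> 1"
    and "u_k = v_opt 0 + K *v (x_k - z_opt 0)"
  shows "\<forall>w_k\<in>W. mpc_feasible A B K X U E r \<Delta>N (k + 1)
           (A *v x_k + B *v u_k + w_k) N_opt (N_opt - 1)"
proof -
  obtain N where N: "N_opt = Suc N"
    using \<open>N_opt \<ge> 1\<close> by (cases N_opt) auto
  have "mpc_constraints A B K X U E r \<Delta>N k x_k N_prev (Suc N) z_opt v_opt"
    using \<open>mpc_optimal A B K X U E r \<Delta>N Q R \<gamma> k x_k N_prev N_opt z_opt v_opt\<close>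
    unfolding mpc_optimal_def N by blast
  from tail_satisfies_constraints[OF \<open>robust_pos_invariant (A + B ** K) W E\<close> this]
  show ?thesis
    unfolding mpc_feasible_def N \<open>u_k = v_opt 0 + K *v (x_k - z_opt 0)\<close> by auto
qed

end
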